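(* Let $K$ be a convex body in $\mathbb{R}^2$ and let $S\subseteq\mathbb{R}^2$, $S\neq\emptyset$. Assume that $K$ is $S$-Kakeya. Then there is a continuous map $f:\operatorname{SO}(2)\to\mathbb{R}^2$ such that $\rho(S)+f(\rho)\subseteq K$ for all $\rho\in\operatorname{SO}(2)$.
   Context: A convex body is a compact convex set. For $S\subseteq\mathbb{R}^d$, a set $K\subseteq\mathbb{R}^d$ is called $S$-Kakeya if for every $\rho\in\operatorname{SO}(d)$ there is some $w\in\mathbb{R}^d$ such that $\rho(S)+w\subseteq K$. *)

theory Defs
  imports "HOL-Analysis.Analysis"
begin

(* A free type variable 'd plays the role of the dimension d. The topology on SO is the
   subspace topology from the matrix space real^'d^'d. *)
definition SO :: "(real^'d^'d) set" where
  "SO = {\<rho>. rotation_matrix \<rho>}"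

(* No interior point is required, so degenerate bodies such as segments are included. *)
definition convex_body :: "(real^'d) set \<Rightarrow> bool" where
  "convex_body K \<longleftrightarrow> compact K \<and> convex K"

definition kakeya :: "(real^'d) set \<Rightarrow> (real^'d) set \<Rightarrow> bool" where
  "kakeya S K \<longleftrightarrow> (\<forall>\<rho>\<in>SO. \<exists>w. (\<lambda>x. \<rho> *v x + w) ` S \<subseteq> K)"

end

theory Submission
  imports Defs
begin

text \<open>
  For a rotation \<open>\<rho>\<close> let \<open>F(\<rho>)\<close> be the set of admissible translations, that is, of all \<open>w\<close>
  with \<open>\<rho>(S) + w \<subseteq> K\<close>. It is compact and convex, and nonempty by the Kakeya property, and
  \<open>f(\<rho>)\<close> can be taken to be its point nearest to the origin.

  The graph of \<open>F\<close> is closed, so the continuity of \<open>f\<close> follows once it is known that every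
  point of \<open>F(\<rho>)\<close> is approximated by points of \<open>F(\<rho>')\<close> for rotations \<open>\<rho>'\<close> near \<open>\<rho>\<close>. This is
  where the plane is special. If \<open>z\<close> and \<open>z + v\<close> lie in a planar
  convex set \<open>K\<close>, then \<open>y + v/2 \<in> K\<close> for every \<open>y \<in> K\<close> close enough to \<open>z\<close>
  (\<open>eventually_half_translate_mem\<close>; a circular cone in space, with \<open>z\<close> on the boundary of
  its base and \<open>z + v\<close> its apex, shows that this fails in dimension three).
  By compactness the required closeness does not depend on \<open>z\<close>
  (\<open>uniform_half_translate_mem\<close>).

  Now let \<open>\<rho>\<^sub>n \<rightarrow> \<rho>\<close> and \<open>f(\<rho>\<^sub>n) \<rightarrow> w\<close>. Then \<open>w \<in> F(\<rho>)\<close>. Put \<open>v = f(\<rho>) - w\<close>. The set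
  \<open>\<rho>\<^sub>n(S) + f(\<rho>\<^sub>n) \<subseteq> K\<close> is uniformly close to \<open>\<rho>(S) + w\<close>, and both \<open>\<rho>(S) + w\<close> and its
  translate by \<open>v\<close> lie in \<open>K\<close>; hence \<open>f(\<rho>\<^sub>n) + v/2 \<in> F(\<rho>\<^sub>n)\<close> for large \<open>n\<close>. Minimality of
  \<open>f(\<rho>\<^sub>n)\<close> gives, in the limit, \<open>|w| \<le> |(w + f(\<rho>))/2|\<close>, so \<open>|w| \<le> |f(\<rho>)|\<close> and \<open>w = f(\<rho>)\<close>
  by uniqueness of the nearest point. As \<open>f\<close> is bounded, a closed graph makes it continuous.
\<close>

section \<open>Translating planar convex sets along a chord\<close>

text \<open>The determinant of the pair \<open>(x, v)\<close>, a linear function of \<open>x\<close>. For \<open>v \<noteq> 0\<close> its sign tells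
  on which side of the line spanned by \<open>v\<close> the point \<open>x\<close> lies.\<close>

definition side :: "real^2 \<Rightarrow> real^2 \<Rightarrow> real" where
  "side v x = x $ 1 * v $ 2 - x $ 2 * v $ 1"

lemma side_diff: "side v (x - y) = side v x - side v y"
  and side_scaleR: "side v (r *\<^sub>R x) = r * side v x"
  by (simp_all add: side_def algebra_simps)

lemma parallel_if_side_zero:
  assumes "side v x = 0" "v \<noteq> 0"
  shows "x = ((x \<bullet> v) / (v \<bullet> v)) *\<^sub>R v"
proof -
  have "(v \<bullet> v) *\<^sub>R x = (x \<bullet> v) *\<^sub>R v"
    using assms(1)
    by (simp add: side_def vec_eq_iff forall_2 inner_vec_def sum_2) algebra
  then have "(1 / (v \<bullet> v)) *\<^sub>R ((v \<bullet> v) *\<^sub>R x) = (1 / (v \<bullet> v)) *\<^sub>R ((x \<bullet> v) *\<^sub>R v)"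
    by simp
  then show ?thesis
    using assms(2) by simp
qed

text \<open>The triangle with vertices \<open>z\<close>, \<open>z + v\<close>, \<open>c\<close> contains, near the midpoint of its side from
  \<open>z\<close> to \<open>z + v\<close>, all points that are on this line or on the same side of it as \<open>c\<close>.\<close>

lemma eventually_half_translate_mem_same_side:
  fixes K :: "(real^2) set"
  assumes K: "convex K" "z \<in> K" "z + v \<in> K" "c \<in> K" and v: "v \<noteq> 0"
  shows "\<forall>\<^sub>F y in nhds z. side v (y - z) = 0 \<or> side v (y - z) * side v (c - z) > 0
           \<longrightarrow> y + (1/2) *\<^sub>R v \<in> K"
proof -
  \<comment> \<open>Barycentric coordinates of \<open>y + v/2\<close>: weight \<open>g y\<close> at \<open>c\<close>, \<open>m y\<close> at \<open>z + v\<close> and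
    \<open>1 - g y - m y\<close> at \<open>z\<close>. The inverse is zero if \<open>c\<close> is on the line, where \<open>c\<close> is not used.\<close>
  define g where "g y = side v (y - z) * inverse (side v (c - z))" for y
  define m where "m y = ((y - z - g y *\<^sub>R (c - z)) \<bullet> v) / (v \<bullet> v) + 1/2" for y
  have g: "(g \<longlongrightarrow> g z) (nhds z)"
    unfolding g_def side_def by (intro tendsto_intros) (simp_all add: filterlim_ident)
  have m: "(m \<longlongrightarrow> m z) (nhds z)"
    unfolding m_def by (intro tendsto_intros g filterlim_ident) (use v in auto)
  have gz: "g z = 0" and mz: "m z = 1/2"
    by (simp_all add: g_def m_def side_def)
  have "\<forall>\<^sub>F y in nhds z. g y < 1/4" "\<forall>\<^sub>F y in nhds z. 1/4 < m y" "\<forall>\<^sub>F y in nhds z. m y < 3/4"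
    by (rule order_tendstoD[OF g] order_tendstoD[OF m], simp add: gz mz)+
  then show ?thesis
  proof eventually_elim
    case (elim y)
    show ?case
    proof
      assume y: "side v (y - z) = 0 \<or> side v (y - z) * side v (c - z) > 0"
      then have g0: "g y \<ge> 0"
        unfolding g_def by (auto simp: zero_less_mult_iff mult_nonpos_nonpos)
      have "side v (y - z - g y *\<^sub>R (c - z)) = 0"
        using y
        by (cases "side v (c - z) = 0") (auto simp: side_diff[of v "y - z"] side_scaleR g_def)
      from parallel_if_side_zero[OF this v]
      have "y - z - g y *\<^sub>R (c - z) = (m y - 1/2) *\<^sub>R v"
        by (simp add: m_def)
      then have "y + (1/2) *\<^sub>R v = (1 - g y - m y) *\<^sub>R z + m y *\<^sub>R (z + v) + g y *\<^sub>R c"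
        by (simp add: algebra_simps)
      also have "\<dots> \<in> K"
      proof -
        have "\<dots> \<in> convex hull {z, z + v, c}"
          unfolding convex_hull_3 using elim g0
          by (intro CollectI exI[of _ "1 - g y - m y"] exI[of _ "m y"] exI[of _ "g y"]) auto
        moreover have "convex hull {z, z + v, c} \<subseteq> K"
          using K by (intro hull_minimal) auto
        ultimately show ?thesis by blast
      qed
      finally show "y + (1/2) *\<^sub>R v \<in> K" .
    qed
  qed
qed

lemma eventually_half_translate_mem:
  fixes K :: "(real^2) set"
  assumes "convex K" "z \<in> K" "z + v \<in> K"
  shows "\<forall>\<^sub>F y in nhds z. y \<in> K \<longrightarrow> y + (1/2) *\<^sub>R v \<in> K"
proof (cases "v = 0")
  case False
  \<comment> \<open>One apex on each side of the line, whenever \<open>K\<close> reaches that side.\<close>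
  have "\<exists>c\<in>K. \<forall>y\<in>K. side v (y - z) > 0 \<longrightarrow> side v (c - z) > 0"
    and "\<exists>c\<in>K. \<forall>y\<in>K. side v (y - z) < 0 \<longrightarrow> side v (c - z) < 0"
    using assms(2) by blast+
  then obtain c d where c: "c \<in> K" "\<And>y. y \<in> K \<Longrightarrow> side v (y - z) > 0 \<Longrightarrow> side v (c - z) > 0"
    and d: "d \<in> K" "\<And>y. y \<in> K \<Longrightarrow> side v (y - z) < 0 \<Longrightarrow> side v (d - z) < 0"
    by blast
  show ?thesis
    using eventually_half_translate_mem_same_side[OF assms c(1) False]
      eventually_half_translate_mem_same_side[OF assms d(1) False]
  proof eventually_elim
    case (elim y)
    then show ?case
      using c(2)[of y] d(2)[of y]
      by (metis linorder_neqE_linordered_idom mult_neg_neg mult_pos_pos)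
  qed
qed simp

text \<open>The compact set of all \<open>z\<close> with \<open>z, z + v \<in> K\<close> admits one radius for all its points:
  otherwise the offending pairs \<open>(y, z)\<close> would accumulate at a point \<open>(l, l)\<close> with
  \<open>l, l + v \<in> K\<close>.\<close>

lemma uniform_half_translate_mem:
  fixes K :: "(real^2) set"
  assumes "compact K" "convex K"
  obtains \<delta> where "\<delta> > 0"
    "\<And>y z. y \<in> K \<Longrightarrow> z \<in> K \<Longrightarrow> z + v \<in> K \<Longrightarrow> dist y z < \<delta> \<Longrightarrow> y + (1/2) *\<^sub>R v \<in> K"
proof (rule ccontr)
  assume "\<not> thesis"
  then have "\<exists>y z. y \<in> K \<and> z \<in> K \<and> z + v \<in> K \<and> dist y z < inverse (real (Suc n))
      \<and> y + (1/2) *\<^sub>R v \<notin> K" for n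
    using that[of "inverse (real (Suc n))"] by
      (metis inverse_positive_iff_positive of_nat_0_less_iff zero_less_Suc)
  then obtain y z where yz: "\<And>n. y n \<in> K" "\<And>n. z n \<in> K" "\<And>n. z n + v \<in> K"
    "\<And>n. dist (y n) (z n) < inverse (real (Suc n))" "\<And>n. y n + (1/2) *\<^sub>R v \<notin> K"
    by metis
  obtain l r where l: "l \<in> K" "strict_mono (r :: nat \<Rightarrow> nat)" "(z \<circ> r) \<longlonglongrightarrow> l"
    using assms(1) yz(2) unfolding compact_eq_seq_compact_metric by (metis seq_compactE)
  have "(\<lambda>n. (z \<circ> r) n + v) \<longlonglongrightarrow> l + v"
    by (intro tendsto_intros l)
  then have lv: "l + v \<in> K"
    by (rule closed_sequentially[OF compact_imp_closed[OF assms(1)], rotated]) (simp add: yz(3))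
  have "(\<lambda>n. dist (y n) (z n)) \<longlonglongrightarrow> 0"
    by (rule tendsto_sandwich[OF _ _ tendsto_const LIMSEQ_inverse_real_of_nat])
      (use yz(4) in \<open>auto intro!: always_eventually less_imp_le\<close>)
  then have "(\<lambda>n. dist ((y \<circ> r) n) ((z \<circ> r) n)) \<longlonglongrightarrow> 0"
    using LIMSEQ_subseq_LIMSEQ[OF _ l(2)] by (fastforce simp: o_def)
  then have "(\<lambda>n. (y \<circ> r) n - (z \<circ> r) n) \<longlonglongrightarrow> 0"
    by (simp add: dist_norm tendsto_norm_zero_iff)
  from tendsto_add[OF this l(3)] have "(y \<circ> r) \<longlonglongrightarrow> l"
    by (simp add: o_def)
  then have "\<forall>\<^sub>F n in sequentially. (y \<circ> r) n \<in> K \<longrightarrow> (y \<circ> r) n + (1/2) *\<^sub>R v \<in> K"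
    using eventually_half_translate_mem[OF assms(2) l(1) lv]
    by (rule eventually_compose_filterlim[rotated])
  then show False
    using yz(1,5) by (auto simp: eventually_sequentially)
qed

section \<open>The admissible translations of a rotated set\<close>

lemma norm_matrix_vector_mult_le:
  fixes A :: "real^'n^'m"
  shows "norm (A *v x) \<le> norm A * norm x"
proof -
  have "norm (A *v x) \<le> L2_set (\<lambda>i. norm (A $ i) * norm x) UNIV"
    unfolding norm_vec_def[of "A *v x"]
    by (intro L2_set_mono) (auto simp: matrix_vector_mul_component Cauchy_Schwarz_ineq2)
  also have "\<dots> = norm A * norm x"
    by (simp add: norm_vec_def[of A] L2_set_left_distrib)
  finally show ?thesis .
qed

lemma norm_SO_mult: "\<rho> \<in> SO \<Longrightarrow> norm (\<rho> *v x) = norm x"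
  by (intro orthogonal_transformation_norm)
    (simp add: SO_def rotation_matrix_def orthogonal_transformation_matrix)

text \<open>The set \<open>F(\<rho>)\<close> of all translation vectors \<open>w\<close> with \<open>\<rho>(S) + w \<subseteq> K\<close>.\<close>

definition admissible :: "(real^'d) set \<Rightarrow> (real^'d) set \<Rightarrow> real^'d^'d \<Rightarrow> (real^'d) set" where
  "admissible K S \<rho> = {w. \<forall>s\<in>S. \<rho> *v s + w \<in> K}"

text \<open>The set-valued map \<open>F\<close> has a closed graph if \<open>K\<close> is closed.\<close>

lemma admissible_limit:
  assumes "closed K" "\<And>n. w n \<in> admissible K S (\<rho> n)" "w \<longlonglongrightarrow> l" "\<rho> \<longlonglongrightarrow> \<sigma>"
  shows "l \<in> admissible K S \<sigma>"
  unfolding admissible_def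
proof clarify
  fix s assume s: "s \<in> S"
  have "(\<lambda>n. (\<rho> n - \<sigma>) *v s) \<longlonglongrightarrow> 0"
  proof (rule Lim_null_comparison)
    show "\<forall>\<^sub>F n in sequentially. norm ((\<rho> n - \<sigma>) *v s) \<le> norm (\<rho> n - \<sigma>) * norm s"
      by (simp add: norm_matrix_vector_mult_le)
    show "(\<lambda>n. norm (\<rho> n - \<sigma>) * norm s) \<longlonglongrightarrow> 0"
      using assms(4) by (intro tendsto_mult_left_zero tendsto_norm_zero LIM_zero)
  qed
  then have "(\<lambda>n. (\<rho> n - \<sigma>) *v s + \<sigma> *v s + w n) \<longlonglongrightarrow> 0 + \<sigma> *v s + l"
    by (intro tendsto_intros assms)
  then have "(\<lambda>n. \<rho> n *v s + w n) \<longlonglongrightarrow> \<sigma> *v s + l"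
    by (simp add: matrix_vector_mult_diff_rdistrib)
  then show "\<sigma> *v s + l \<in> K"
    by (rule closed_sequentially[OF assms(1), rotated]) (use assms(2) s in \<open>simp add: admissible_def\<close>)
qed

lemma closed_admissible: "closed K \<Longrightarrow> closed (admissible K S \<rho>)"
  unfolding closed_sequential_limits[of "admissible K S \<rho>"]
  using admissible_limit[of K _ S "\<lambda>_. \<rho>", OF _ _ _ tendsto_const] by blast

lemma convex_admissible:
  assumes "convex K" shows "convex (admissible K S \<rho>)"
proof (rule convexI)
  fix x y and a b :: real
  assume ab: "x \<in> admissible K S \<rho>" "y \<in> admissible K S \<rho>" "0 \<le> a" "0 \<le> b" "a + b = 1"
  have "\<rho> *v s + (a *\<^sub>R x + b *\<^sub>R y) = a *\<^sub>R (\<rho> *v s + x) + b *\<^sub>R (\<rho> *v s + y)" for s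
    using ab(5) by (simp add: algebra_simps flip: scaleR_add_left)
  then show "a *\<^sub>R x + b *\<^sub>R y \<in> admissible K S \<rho>"
    using ab assms by (auto simp: admissible_def intro: convexD)
qed

section \<open>The shortest admissible translation is continuous\<close>

theorem theorem1p4:
  fixes K S :: "(real^2) set"
  assumes "convex_body K"
    and "S \<noteq> {}"
    and "kakeya S K"
  shows "\<exists>f :: real^2^2 \<Rightarrow> real^2. continuous_on SO f \<and>
           (\<forall>\<rho>\<in>SO. (\<lambda>x. \<rho> *v x + f \<rho>) ` S \<subseteq> K)"
proof -
  have K: "compact K" "convex K" "closed K"
    using assms(1) by (auto simp: convex_body_def compact_imp_closed)
  define F where "F = admissible K S"
  define f where "f \<rho> = closest_point (F \<rho>) 0" for \<rho>
  have F: "closed (F \<rho>)" "convex (F \<rho>)" for \<rho>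
    by (simp_all add: F_def closed_admissible convex_admissible K)
  have fF: "f \<rho> \<in> F \<rho>" if "\<rho> \<in> SO" for \<rho>
  proof -
    have "F \<rho> \<noteq> {}"
      using assms(3) that by (fastforce simp: kakeya_def F_def admissible_def)
    then show ?thesis
      unfolding f_def using F by (intro closest_point_in_set)
  qed
  have f_le: "norm (f \<rho>) \<le> norm w" if "w \<in> F \<rho>" for \<rho> w
    using closest_point_le[OF F(1) that, of 0] by (simp add: f_def)
  have f_mem: "\<rho> *v s + f \<rho> \<in> K" if "\<rho> \<in> SO" "s \<in> S" for \<rho> s
    using fF[OF that(1)] that(2) by (simp add: F_def admissible_def)
  obtain M where M: "\<And>x. x \<in> K \<Longrightarrow> norm x \<le> M"
    using compact_imp_bounded[OF K(1)] by (auto simp: bounded_iff)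
  \<comment> \<open>The identity is a rotation, so a translate of \<open>S\<close> lies in \<open>K\<close>.\<close>
  have id: "mat 1 \<in> (SO :: (real^2^2) set)"
    by (simp add: SO_def rotation_matrix_def orthogonal_matrix_id)
  define B where "B = M + norm (f (mat 1))"
  have B: "norm s \<le> B" if "s \<in> S" for s
    using M[OF f_mem[OF id that]] norm_triangle_ineq4[of "s + f (mat 1)" "f (mat 1)"]
    by (simp add: B_def)
  have fim: "f \<in> SO \<rightarrow> cball 0 (M + B)"
  proof
    fix \<rho> :: "real^2^2" assume \<rho>: "\<rho> \<in> SO"
    obtain s where s: "s \<in> S" using assms(2) by blast
    have "norm (f \<rho>) \<le> norm (\<rho> *v s + f \<rho>) + norm (\<rho> *v s)"
      using norm_triangle_ineq4[of "\<rho> *v s + f \<rho>" "\<rho> *v s"] by simp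
    then show "f \<rho> \<in> cball 0 (M + B)"
      using M[OF f_mem[OF \<rho> s]] B[OF s] norm_SO_mult[OF \<rho>, of s] by simp
  qed
  \<comment> \<open>The graph of \<open>f\<close> is closed relative to \<open>SO\<close>.\<close>
  have graph: "w = f \<sigma>" if \<rho>: "\<And>n. \<rho> n \<in> SO" and \<sigma>: "\<sigma> \<in> SO"
    and lim: "\<rho> \<longlonglongrightarrow> \<sigma>" "(\<lambda>n. f (\<rho> n)) \<longlonglongrightarrow> w" for \<rho> \<sigma> w
  proof -
    have w: "w \<in> F \<sigma>"
      unfolding F_def by (rule admissible_limit[OF K(3) _ lim(2,1)]) (use fF \<rho> in \<open>simp add: F_def\<close>)
    define v where "v = f \<sigma> - w"
    obtain \<delta> where \<delta>: "\<delta> > 0"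
      "\<And>y z. y \<in> K \<Longrightarrow> z \<in> K \<Longrightarrow> z + v \<in> K \<Longrightarrow> dist y z < \<delta> \<Longrightarrow> y + (1/2) *\<^sub>R v \<in> K"
      using uniform_half_translate_mem[OF K(1,2)] by metis
    have "(\<lambda>n. norm (\<rho> n - \<sigma>) * B + norm (f (\<rho> n) - w)) \<longlonglongrightarrow> 0 * B + 0"
      using lim by (intro tendsto_intros tendsto_norm_zero LIM_zero)
    then have "\<forall>\<^sub>F n in sequentially. norm (\<rho> n - \<sigma>) * B + norm (f (\<rho> n) - w) < \<delta>"
      using order_tendstoD(2) \<delta>(1) by fastforce
    then have "\<forall>\<^sub>F n in sequentially. norm (f (\<rho> n)) \<le> norm (f (\<rho> n) + (1/2) *\<^sub>R v)"
    proof eventually_elim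
      case (elim n)
      \<comment> \<open>Compare with \<open>z = \<sigma> s + w\<close>, where \<open>z + v = \<sigma> s + f \<sigma>\<close>; the distance is below \<open>\<delta>\<close>
        uniformly in \<open>s\<close> because \<open>S\<close> is bounded.\<close>
      have "\<rho> n *v s + f (\<rho> n) + (1/2) *\<^sub>R v \<in> K" if s: "s \<in> S" for s
      proof (rule \<delta>(2)[of _ "\<sigma> *v s + w"])
        show "\<rho> n *v s + f (\<rho> n) \<in> K" "\<sigma> *v s + w \<in> K" "\<sigma> *v s + w + v \<in> K"
          using f_mem \<rho> \<sigma> s w by (auto simp: F_def admissible_def v_def)
        have "dist (\<rho> n *v s + f (\<rho> n)) (\<sigma> *v s + w) = norm ((\<rho> n - \<sigma>) *v s + (f (\<rho> n) - w))"
          by (simp add: dist_norm matrix_vector_mult_diff_rdistrib algebra_simps)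
        also have "\<dots> \<le> norm (\<rho> n - \<sigma>) * norm s + norm (f (\<rho> n) - w)"
          by (intro norm_triangle_le add_right_mono norm_matrix_vector_mult_le)
        also have "\<dots> \<le> norm (\<rho> n - \<sigma>) * B + norm (f (\<rho> n) - w)"
          by (intro add_right_mono mult_left_mono B s norm_ge_zero)
        finally show "dist (\<rho> n *v s + f (\<rho> n)) (\<sigma> *v s + w) < \<delta>"
          using elim by simp
      qed
      then have "f (\<rho> n) + (1/2) *\<^sub>R v \<in> F (\<rho> n)"
        by (simp add: F_def admissible_def add.assoc)
      then show ?case
        by (rule f_le)
    qed
    then have "norm w \<le> norm (w + (1/2) *\<^sub>R v)"
      by (rule tendsto_le[OF sequentially_bot, rotated 2]) (intro tendsto_intros lim)+
    also have "w + (1/2) *\<^sub>R v = (1/2) *\<^sub>R w + (1/2) *\<^sub>R f \<sigma>"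
      by (simp add: v_def vec_eq_iff field_simps)
    also have "norm \<dots> \<le> norm w / 2 + norm (f \<sigma>) / 2"
      by (rule norm_triangle_le) simp
    finally have "norm w \<le> norm (f \<sigma>)"
      by simp
    then have "\<forall>z\<in>F \<sigma>. dist 0 w \<le> dist 0 z"
      using f_le by fastforce
    then show "w = f \<sigma>"
      unfolding f_def using F w by (intro closest_point_unique)
  qed
  have "closedin (top_of_set (SO \<times> cball 0 (M + B))) ((\<lambda>\<rho>. (\<rho>, f \<rho>)) ` SO)"
    unfolding closedin_limpt
  proof (intro conjI allI impI)
    show "(\<lambda>\<rho>. (\<rho>, f \<rho>)) ` SO \<subseteq> SO \<times> cball 0 (M + B)"
      using fim by auto
    fix p assume p: "p islimpt (\<lambda>\<rho>. (\<rho>, f \<rho>)) ` SO \<and> p \<in> SO \<times> cball 0 (M + B)"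
    then obtain q where q: "\<And>n. q n \<in> (\<lambda>\<rho>. (\<rho>, f \<rho>)) ` SO" "q \<longlonglongrightarrow> p"
      unfolding islimpt_sequential by blast
    from q(1) have "fst (q n) \<in> SO" "f (fst (q n)) = snd (q n)" for n
      by (metis (no_types, lifting) fst_conv snd_conv imageE)+
    then have "snd p = f (fst p)"
      using p by (intro graph[of "\<lambda>n. fst (q n)"]) (auto intro!: tendsto_fst tendsto_snd q(2))
    then show "p \<in> (\<lambda>\<rho>. (\<rho>, f \<rho>)) ` SO"
      using p by (auto simp: image_iff)
  qed
  then have "continuous_on SO f"
    using continuous_closed_graph_eq[OF compact_cball fim] by simp
  then show ?thesis
    using f_mem by (intro exI[of _ f]) auto
qed

end
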